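(* There is an absolute constant $c>0$ such that for every $n\ge 1$, every function $f:\{0,1\}^n\to\{0,1\}$, every integer $k\ge 2$, and every $0\le\varepsilon\le\frac1{20}$, \[ \overline{\mathrm{R}}_\varepsilon(f^k) \ge c\cdot k\cdot \overline{\mathrm{R}}_{\varepsilon/k}(f). \]
   Context: For $f:\{0,1\}^n\to\{0,1\}$ and $k\ge 2$, $f^k:\{0,1\}^{nk}\to\{0,1\}^k$ is defined by $f^k(x^{(1)},\dots,x^{(k)})=(f(x^{(1)}),\dots,f(x^{(k)}))$. A randomized query algorithm adaptively queries input bits (using internal randomness) and outputs a value; it computes a function $g$ with error $\varepsilon$ if on every input $x$ it outputs exactly $g(x)$ with probability at least $1-\varepsilon$. $\overline{\mathrm{R}}_\varepsilon(g)$ is the minimum, over algorithms computing $g$ with error at most $\varepsilon$, of the maximum over inputs $x$ of the expected number of queries made on $x$. *)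

theory Defs
  imports "HOL-Probability.Probability"
begin

text \<open>
  The set \<open>{0,1}\<^sup>n\<close> is \<open>cube n\<close>, the Boolean lists of length \<open>n\<close>. A function on \<open>{0,1}\<^sup>n\<close> is
  a HOL function on \<open>bool list\<close>; all notions below only look at its values on \<open>cube n\<close>.
\<close>

definition cube :: "nat \<Rightarrow> bool list set" where
  "cube n = {x. length x = n}"

text \<open>Block \<open>i\<close> (\<open>i < k\<close>) of an input of length \<open>n * k\<close> occupies positions \<open>i * n, ..., i * n + n - 1\<close>.\<close>

definition block :: "nat \<Rightarrow> nat \<Rightarrow> bool list \<Rightarrow> bool list" where
  "block n i x = take n (drop (i * n) x)"

definition direct_sum :: "nat \<Rightarrow> nat \<Rightarrow> (bool list \<Rightarrow> bool) \<Rightarrow> bool list \<Rightarrow> bool list" where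
  "direct_sum n k f x = map (\<lambda>i. f (block n i x)) [0..<k]"

text \<open>\<open>Query i l r\<close> reads bit \<open>i\<close> and continues with \<open>l\<close> on answer 0 and with \<open>r\<close> on answer 1.\<close>

datatype 'o dtree = Output 'o | Query nat "'o dtree" "'o dtree"

primrec queried :: "'o dtree \<Rightarrow> nat set" where
  "queried (Output v) = {}"
| "queried (Query i l r) = insert i (queried l \<union> queried r)"

primrec run :: "'o dtree \<Rightarrow> bool list \<Rightarrow> 'o" where
  "run (Output v) x = v"
| "run (Query i l r) x = (if x ! i then run r x else run l x)"

primrec num_queries :: "'o dtree \<Rightarrow> bool list \<Rightarrow> nat" where
  "num_queries (Output v) x = 0"
| "num_queries (Query i l r) x = Suc (if x ! i then num_queries r x else num_queries l x)"

text \<open>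
  A randomized query algorithm is a probability distribution over deterministic decision trees:
  the internal randomness is drawn first and determines the tree that is then run. Trees of
  unbounded depth may occur in the support, so that expected query counts are taken in
  \<open>ennreal\<close>, where they are infinite rather than 0 when they diverge.
\<close>

definition query_algorithm :: "nat \<Rightarrow> 'o dtree pmf \<Rightarrow> bool" where
  "query_algorithm n A \<longleftrightarrow> (\<forall>T \<in> set_pmf A. queried T \<subseteq> {..<n})"

definition computes :: "nat \<Rightarrow> 'o dtree pmf \<Rightarrow> (bool list \<Rightarrow> 'o) \<Rightarrow> real \<Rightarrow> bool" where
  "computes n A g \<epsilon> \<longleftrightarrow>
     (\<forall>x \<in> cube n. measure_pmf.prob A {T. run T x = g x} \<ge> 1 - \<epsilon>)"

definition expected_queries :: "'o dtree pmf \<Rightarrow> bool list \<Rightarrow> ennreal" where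
  "expected_queries A x = (\<integral>\<^sup>+ T. of_nat (num_queries T x) \<partial>measure_pmf A)"

text \<open>
  \<open>Rbar n \<epsilon> g\<close> is the complexity of \<open>g\<close> on \<open>{0,1}\<^sup>n\<close>. The supremum ranges over the finite nonempty
  set of inputs, so it is a maximum. The infimum is a minimum when \<open>\<epsilon> \<ge> 0\<close>: algorithms may be
  assumed not to repeat a query on any path and to output only values of \<open>g\<close>, which leaves
  finitely many trees, hence a compact set of distributions.
\<close>

definition Rbar :: "nat \<Rightarrow> real \<Rightarrow> (bool list \<Rightarrow> 'o) \<Rightarrow> ennreal" where
  "Rbar n \<epsilon> g =
     (INF A \<in> {A. query_algorithm n A \<and> computes n A g \<epsilon>}. SUP x \<in> cube n. expected_queries A x)"

end

theory Submission
  imports Defs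
begin

text \<open>
  An algorithm for \<open>f\<^sup>k\<close> with expected cost \<open>q\<close> is turned into one for \<open>f\<close> by placing the input in a random block \<open>i\<close>,
  sampling the other blocks from a distribution \<open>\<mu>\<close> on inputs, and aborting if one of the outputs
  before \<open>i\<close> is wrong or block \<open>i\<close> receives more than \<open>20 q / k\<close> queries. A run that is wrong
  somewhere has exactly one first wrong coordinate, so averaged over \<open>i\<close> the non-aborting error is
  at most \<open>\<epsilon> / k\<close>, while the abort probability stays below \<open>1 / 10\<close>. The loss that charges \<open>1\<close> for
  an abort and \<open>W = k / (4 \<epsilon>)\<close> for an error is therefore at most \<open>7 / 20\<close> on average, for each \<open>\<mu>\<close>,
  and the minimax principle gives a randomized algorithm whose loss is at most \<open>1 / 2\<close> on every
  input. Its error \<open>2 \<epsilon> / k\<close> is squared by accepting only when two independent runs agree, and the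
  aborts are removed by repetition, at the price of a constant factor.
\<close>

section \<open>Approximate minimax by repeated best responses\<close>

text \<open>For \<open>u \<ge> 0\<close> this is the expanded square; for \<open>u < 0\<close> the
  cross term vanishes and the positive part of \<open>u + d\<close> is at most
  \<open>\<bar>d\<bar>\<close>.\<close>

lemma positive_part_step: "(max 0 (u + d))\<^sup>2 \<le> (max 0 u)\<^sup>2 + 2 * (max 0 u * d) + d\<^sup>2" for u d :: real
proof (cases "u \<ge> 0")
  case True
  have "(max 0 (u + d))\<^sup>2 \<le> (u + d)\<^sup>2"
    by (simp add: max_def)
  with True show ?thesis
    by (simp add: power2_sum)
next
  case False
  then have "max 0 (u + d) \<le> \<bar>d\<bar>"
    by linarith
  then have "(max 0 (u + d))\<^sup>2 \<le> \<bar>d\<bar>\<^sup>2"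
    by (intro power_mono) auto
  with False show ?thesis
    by simp
qed

text \<open>The potential is the squared distance of the cumulative loss vector from the negative orthant;
  responding to its gradient keeps the growth linear, so the average loss violates the bound \<open>v\<close> by
  \<open>O(1 / sqrt t)\<close> after \<open>t\<close> rounds.\<close>

lemma approximate_minimax:
  fixes c :: "'t \<Rightarrow> 'x \<Rightarrow> real"
  assumes "finite X"
    and bound: "\<And>T x. T \<in> \<T> \<Longrightarrow> x \<in> X \<Longrightarrow> \<bar>c T x\<bar> \<le> B"
    and response: "\<And>w. (\<And>x. 0 \<le> w x) \<Longrightarrow> \<exists>T\<in>\<T>. (\<Sum>x\<in>X. w x * c T x) \<le> (\<Sum>x\<in>X. w x) * v"
    and "\<eta> > 0"
  shows "\<exists>p. set_pmf p \<subseteq> \<T> \<and> (\<forall>x\<in>X. measure_pmf.expectation p (\<lambda>T. c T x) \<le> v + \<eta>)"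
proof -
  have "\<exists>br. \<forall>w. (\<forall>x. 0 \<le> w x) \<longrightarrow> br w \<in> \<T> \<and> (\<Sum>x\<in>X. w x * c (br w) x) \<le> (\<Sum>x\<in>X. w x) * v"
    using response by (intro choice) blast
  then obtain br where br: "\<And>w. (\<And>x. 0 \<le> w x) \<Longrightarrow> br w \<in> \<T>"
      "\<And>w. (\<And>x. 0 \<le> w x) \<Longrightarrow> (\<Sum>x\<in>X. w x * c (br w) x) \<le> (\<Sum>x\<in>X. w x) * v"
    by blast
  \<comment> \<open>\<open>U t x\<close> is the excess of the loss on \<open>x\<close> over
    \<open>v\<close> accumulated in \<open>t\<close> rounds. Its positive parts are the weights to
    which \<open>br\<close> responds next.\<close>
  define U where "U = rec_nat (\<lambda>_. 0) (\<lambda>_ u x. u x + (c (br (\<lambda>x. max 0 (u x))) x - v))"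
  define S where "S t = br (\<lambda>x. max 0 (U t x))" for t
  have U0: "U 0 x = 0" and USuc: "U (Suc t) x = U t x + (c (S t) x - v)" for t x
    by (simp_all add: U_def S_def)
  have S_in: "S t \<in> \<T>" for t
    unfolding S_def by (rule br(1)) simp
  \<comment> \<open>The response inequality makes the cross terms of
    \<open>positive_part_step\<close>, summed over \<open>X\<close>, nonpositive.\<close>
  have S_best: "(\<Sum>x\<in>X. max 0 (U t x) * (c (S t) x - v)) \<le> 0" for t
    using br(2)[of "\<lambda>x. max 0 (U t x)"] by (simp add: S_def algebra_simps sum_subtractf sum_distrib_left)
  define K where "K = real (card X) * (B + \<bar>v\<bar>)\<^sup>2"
  have potential: "(\<Sum>x\<in>X. (max 0 (U t x))\<^sup>2) \<le> real t * K" for t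
  proof (induction t)
    case 0
    then show ?case by (simp add: U0)
  next
    case (Suc t)
    have step: "(c (S t) x - v)\<^sup>2 \<le> (B + \<bar>v\<bar>)\<^sup>2" if "x \<in> X" for x
      using bound[OF S_in that, of t] by (intro abs_le_square_iff[THEN iffD1]) linarith
    have "(\<Sum>x\<in>X. (max 0 (U (Suc t) x))\<^sup>2)
        \<le> (\<Sum>x\<in>X. (max 0 (U t x))\<^sup>2 + 2 * (max 0 (U t x) * (c (S t) x - v)) + (c (S t) x - v)\<^sup>2)"
      unfolding USuc by (intro sum_mono positive_part_step)
    also have "\<dots> = (\<Sum>x\<in>X. (max 0 (U t x))\<^sup>2) + 2 * (\<Sum>x\<in>X. max 0 (U t x) * (c (S t) x - v))
        + (\<Sum>x\<in>X. (c (S t) x - v)\<^sup>2)"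
      by (simp only: sum.distrib sum_distrib_left)
    also have "(\<Sum>x\<in>X. (c (S t) x - v)\<^sup>2) \<le> K"
      unfolding K_def by (rule sum_bounded_above) (rule step)
    also note Suc.IH
    finally show ?case
      using S_best[of t] by (simp add: algebra_simps)
  qed
  \<comment> \<open>The potential bounds each excess by \<open>sqrt (t * K)\<close>, which is at
    most \<open>t * \<eta>\<close> once \<open>t \<ge> K / \<eta>\<^sup>2\<close>.\<close>
  obtain t where t: "t > 0" "K \<le> real t * \<eta>\<^sup>2"
  proof -
    obtain m where "K / \<eta>\<^sup>2 \<le> real m"
      using real_arch_simple by blast
    then have "K \<le> real m * \<eta>\<^sup>2"
      using \<open>\<eta> > 0\<close> by (simp add: field_simps)
    also have "\<dots> \<le> real (Suc m) * \<eta>\<^sup>2"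
      by (intro mult_right_mono) auto
    finally show thesis
      using that[of "Suc m"] by simp
  qed
  have small: "U t x \<le> real t * \<eta>" if "x \<in> X" for x
  proof -
    have "(max 0 (U t x))\<^sup>2 \<le> (\<Sum>x\<in>X. (max 0 (U t x))\<^sup>2)"
      using \<open>finite X\<close> that by (intro member_le_sum) auto
    also have "\<dots> \<le> real t * K"
      by (rule potential)
    also have "\<dots> \<le> real t * (real t * \<eta>\<^sup>2)"
      using t by (intro mult_left_mono) auto
    finally have "(max 0 (U t x))\<^sup>2 \<le> (real t * \<eta>)\<^sup>2"
      by (simp add: power2_eq_square mult_ac)
    then have "max 0 (U t x) \<le> real t * \<eta>"
      by (rule power2_le_imp_le) (use \<open>\<eta> > 0\<close> in auto)
    then show ?thesis by simp
  qed
  have U_sum: "U m x = (\<Sum>s<m. c (S s) x) - real m * v" for m x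
    by (induction m) (auto simp: U0 USuc algebra_simps)
  \<comment> \<open>Uniform over the rounds, so the expected loss on \<open>x\<close> is
    \<open>v + U t x / t\<close>.\<close>
  let ?p = "map_pmf S (pmf_of_set {..<t})"
  have "measure_pmf.expectation ?p (\<lambda>T. c T x) \<le> v + \<eta>" if "x \<in> X" for x
  proof -
    have "measure_pmf.expectation ?p (\<lambda>T. c T x) = (\<Sum>s<t. c (S s) x) / real t"
      using t by (simp add: integral_pmf_of_set lessThan_empty_iff)
    also have "\<dots> \<le> v + \<eta>"
      using small[OF that] t by (simp add: U_sum field_simps)
    finally show ?thesis .
  qed
  moreover have "set_pmf ?p \<subseteq> \<T>"
    using S_in by auto
  ultimately show ?thesis by blast
qed

section \<open>Averaging and independence for discrete distributions\<close>

text \<open>If every value on the nonempty support exceeded \<open>v\<close>, so would the average.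
  Used to fix random choices one at a time.\<close>

lemma nn_integral_pmf_le_imp_ex:
  assumes "(\<integral>\<^sup>+z. g z \<partial>measure_pmf p) \<le> v" "v \<noteq> \<top>"
  shows "\<exists>z\<in>set_pmf p. g z \<le> v"
proof (rule ccontr)
  assume "\<not> ?thesis"
  then have *: "v < g z" if "z \<in> set_pmf p" for z
    using that by (auto simp: not_le)
  have "(\<integral>\<^sup>+z. v \<partial>measure_pmf p) < (\<integral>\<^sup>+z. g z \<partial>measure_pmf p)"
  proof (rule nn_integral_less)
    show "\<not> (AE z in measure_pmf p. g z \<le> v)"
      using * set_pmf_not_empty[of p] by (auto simp: AE_measure_pmf_iff not_le)
  qed (use * assms in \<open>auto simp: AE_measure_pmf_iff less_imp_le\<close>)
  with assms show False by simp
qed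

lemma prob_pair_pmf_Times:
  "measure_pmf.prob (pair_pmf M N) (A \<times> B) = measure_pmf.prob M A * measure_pmf.prob N B"
proof -
  have "emeasure (pair_pmf M N) (A \<times> B) = (\<integral>\<^sup>+z. indicator (A \<times> B) z \<partial>pair_pmf M N)"
    by simp
  also have "\<dots> = (\<integral>\<^sup>+a. \<integral>\<^sup>+b. indicator A a * indicator B b \<partial>N \<partial>M)"
    by (simp only: nn_integral_pair_pmf' indicator_times fst_conv snd_conv)
  also have "\<dots> = emeasure M A * emeasure N B"
    by (simp add: nn_integral_cmult nn_integral_multc)
  finally have "ennreal (measure_pmf.prob (pair_pmf M N) (A \<times> B))
      = ennreal (measure_pmf.prob M A * measure_pmf.prob N B)"
    by (simp add: measure_pmf.emeasure_eq_measure ennreal_mult'')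
  then show ?thesis
    by (simp add: ennreal_inj)
qed

lemma prob_pmf_not: "measure_pmf.prob p {x. \<not> P x} = 1 - measure_pmf.prob p {x. P x}"
  using measure_pmf.prob_neg[of p P] by simp

section \<open>Exhaustive querying and composition of trees\<close>

lemma finite_cube: "finite (cube n)"
  using finite_lists_length_eq[of "UNIV :: bool set" n] by (simp add: cube_def)

text \<open>\<open>xs\<close> holds the answers already read, so the next position is
  \<open>length xs\<close>. Started at \<open>[]\<close>, the tree computes \<open>f\<close> exactly
  on inputs of length \<open>m\<close>.\<close>

primrec full_tree :: "(bool list \<Rightarrow> 'o) \<Rightarrow> nat \<Rightarrow> bool list \<Rightarrow> 'o dtree" where
  "full_tree f 0 xs = Output (f xs)"
| "full_tree f (Suc m) xs =
     Query (length xs) (full_tree f m (xs @ [False])) (full_tree f m (xs @ [True]))"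

lemma queried_full_tree: "queried (full_tree f m xs) \<subseteq> {..<length xs + m}"
proof (induction m arbitrary: xs)
  case (Suc m)
  then show ?case
    using Suc[of "xs @ [False]"] Suc[of "xs @ [True]"] by auto
qed simp

lemma num_queries_full_tree: "num_queries (full_tree f m xs) x = m"
  by (induction m arbitrary: xs) auto

lemma run_full_tree: "run (full_tree f (length ys) xs) (xs @ ys) = f (xs @ ys)"
proof (induction ys arbitrary: xs)
  case (Cons y ys)
  show ?case
    using Cons[of "xs @ [y]"] by (cases y) auto
qed simp

primrec bind_tree :: "'a dtree \<Rightarrow> ('a \<Rightarrow> 'b dtree) \<Rightarrow> 'b dtree" where
  "bind_tree (Output v) g = g v"
| "bind_tree (Query i l r) g = Query i (bind_tree l g) (bind_tree r g)"

lemma run_bind_tree: "run (bind_tree T g) x = run (g (run T x)) x"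
  by (induction T) auto

lemma num_queries_bind_tree:
  "num_queries (bind_tree T g) x = num_queries T x + num_queries (g (run T x)) x"
  by (induction T) auto

lemma queried_bind_tree: "queried (bind_tree T g) \<subseteq> queried T \<union> (\<Union>v. queried (g v))"
  by (induction T) auto

text \<open>\<open>None\<close> encodes an abort. Bits read by \<open>T\<close> may be read again by
  \<open>S\<close> and are then counted twice.\<close>

definition or_else :: "'o option dtree \<Rightarrow> 'o dtree \<Rightarrow> 'o dtree" where
  "or_else T S = bind_tree T (case_option S Output)"

lemma run_or_else: "run (or_else T S) x = (case run T x of None \<Rightarrow> run S x | Some b \<Rightarrow> b)"
  by (simp add: or_else_def run_bind_tree split: option.split)

lemma num_queries_or_else:
  "num_queries (or_else T S) x = num_queries T x + (if run T x = None then num_queries S x else 0)"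
  by (simp add: or_else_def num_queries_bind_tree split: option.split)

lemma queried_or_else: "queried (or_else T S) \<subseteq> queried T \<union> queried S"
  using queried_bind_tree[of T "case_option S Output"]
  by (auto simp: or_else_def split: option.splits)

text \<open>An abort of either run yields \<open>None\<close>: if both abort, the common value is
  itself \<open>None\<close>.\<close>

definition agree :: "'o option dtree \<Rightarrow> 'o option dtree \<Rightarrow> 'o option dtree" where
  "agree T S = bind_tree T (\<lambda>a. bind_tree S (\<lambda>b. Output (if a = b then a else None)))"

lemma run_agree: "run (agree T S) x = (if run T x = run S x then run T x else None)"
  by (simp add: agree_def run_bind_tree)

lemma num_queries_agree: "num_queries (agree T S) x = num_queries T x + num_queries S x"
  by (simp add: agree_def num_queries_bind_tree)

lemma queried_agree: "queried (agree T S) \<subseteq> queried T \<union> queried S"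
proof -
  have "queried (bind_tree S (\<lambda>b. Output (if a = b then a else None))) \<subseteq> queried S" for a
    using queried_bind_tree[of S "\<lambda>b. Output (if a = b then a else None)"] by auto
  then show ?thesis
    using queried_bind_tree[of T "\<lambda>a. bind_tree S (\<lambda>b. Output (if a = b then a else None))"]
    by (fastforce simp: agree_def)
qed

section \<open>Removing aborts by repetition and squaring the error\<close>

primrec retry :: "nat \<Rightarrow> 'o option dtree pmf \<Rightarrow> 'o dtree \<Rightarrow> 'o dtree pmf" where
  "retry 0 P S = return_pmf S"
| "retry (Suc m) P S = map_pmf (\<lambda>(T, T'). or_else T T') (pair_pmf P (retry m P S))"

lemma query_algorithm_retry:
  assumes "query_algorithm n P" "queried S \<subseteq> {..<n}"
  shows "query_algorithm n (retry m P S)"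
proof (induction m)
  case 0
  then show ?case using assms by (simp add: query_algorithm_def)
next
  case (Suc m)
  then show ?case
    using assms queried_or_else unfolding query_algorithm_def by fastforce
qed

text \<open>Geometric series: an attempt costs at most \<open>d\<close>, and the independent
  remainder is run with probability at most \<open>3 / 4\<close>. The value \<open>4 * d\<close> is
  the fixed point of \<open>c = d + 3 / 4 * c\<close>.\<close>

lemma expected_queries_retry:
  assumes "measure_pmf.prob P {T. run T x = None} \<le> 3 / 4"
    and "\<And>T. T \<in> set_pmf P \<Longrightarrow> num_queries T x \<le> d"
  shows "expected_queries (retry m P S) x \<le> ennreal (4 * real d + (3 / 4) ^ m * real (num_queries S x))"
proof (induction m)
  case 0
  then show ?case
    by (simp add: expected_queries_def ennreal_of_nat_eq_real_of_nat)
next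
  case (Suc m)
  let ?N = "{T. run T x = None}"
  have "expected_queries (retry (Suc m) P S) x =
      (\<integral>\<^sup>+T. \<integral>\<^sup>+T'. of_nat (num_queries (or_else T T') x) \<partial>retry m P S \<partial>P)"
    by (simp add: expected_queries_def nn_integral_pair_pmf')
  also have "\<dots> = (\<integral>\<^sup>+T. \<integral>\<^sup>+T'. of_nat (num_queries T x) + indicator ?N T * of_nat (num_queries T' x) \<partial>retry m P S \<partial>P)"
    by (intro nn_integral_cong) (auto simp: num_queries_or_else)
  also have "\<dots> = (\<integral>\<^sup>+T. of_nat (num_queries T x) \<partial>P)
      + emeasure P ?N * expected_queries (retry m P S) x"
    by (simp add: nn_integral_add nn_integral_cmult nn_integral_multc expected_queries_def)
  also have "(\<integral>\<^sup>+T. of_nat (num_queries T x) \<partial>P) \<le> (\<integral>\<^sup>+T. of_nat d \<partial>P)"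
    using assms(2) by (intro nn_integral_mono_AE) (auto simp: AE_measure_pmf_iff)
  also have "(\<integral>\<^sup>+T. of_nat d \<partial>P) = ennreal (real d)"
    by (simp add: ennreal_of_nat_eq_real_of_nat)
  also have "emeasure P ?N * expected_queries (retry m P S) x
      \<le> ennreal (3 / 4) * ennreal (4 * real d + (3 / 4) ^ m * real (num_queries S x))"
    using assms(1) by (intro mult_mono Suc.IH) (auto simp: measure_pmf.emeasure_eq_measure intro: ennreal_leI)
  also have "ennreal (real d) + \<dots>
      = ennreal (real d + 3 / 4 * (4 * real d + (3 / 4) ^ m * real (num_queries S x)))"
    by (simp add: ennreal_mult'' [symmetric] ennreal_plus [symmetric] del: ennreal_plus)
  also have "real d + 3 / 4 * (4 * real d + (3 / 4) ^ m * real (num_queries S x))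
      = 4 * real d + (3 / 4) ^ Suc m * real (num_queries S x)"
    by (simp add: algebra_simps)
  finally show ?case
    by (simp add: add_mono)
qed

text \<open>The same recursion for errors, with fixed point \<open>4 * \<delta>\<close>: either the
  first attempt outputs a wrong bit, or it aborts and the remainder errs. The fallback
  \<open>S\<close> is correct on \<open>x\<close>.\<close>

lemma error_retry:
  assumes "measure_pmf.prob P {T. run T x = None} \<le> 3 / 4"
    and "measure_pmf.prob P {T. \<exists>b. run T x = Some b \<and> b \<noteq> y} \<le> \<delta>"
    and "run S x = y"
  shows "measure_pmf.prob (retry m P S) {T. run T x \<noteq> y} \<le> 4 * \<delta>"
proof (induction m)
  case 0
  have "0 \<le> \<delta>"
    using assms(2) measure_nonneg order_trans by blast
  then show ?case using assms(3) by (simp add: indicator_def)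
next
  case (Suc m)
  let ?E = "{T. \<exists>b. run T x = Some b \<and> b \<noteq> y}" and ?N = "{T. run T x = None}"
  let ?Q = "pair_pmf P (retry m P S)"
  have "measure_pmf.prob (retry (Suc m) P S) {T. run T x \<noteq> y}
      = measure_pmf.prob ?Q {(T, T'). run (or_else T T') x \<noteq> y}"
    by (simp add: vimage_def case_prod_unfold)
  also have "{(T, T'). run (or_else T T') x \<noteq> y} = ?E \<times> UNIV \<union> ?N \<times> {T. run T x \<noteq> y}"
    by (auto simp: run_or_else split: option.splits)
  also have "measure_pmf.prob ?Q \<dots> \<le> measure_pmf.prob ?Q (?E \<times> UNIV) 
      + measure_pmf.prob ?Q (?N \<times> {T. run T x \<noteq> y})"
    by (rule measure_Un_le) auto
  also have "\<dots> = measure_pmf.prob P ?E + measure_pmf.prob P ?N * measure_pmf.prob (retry m P S) {T. run T x \<noteq> y}"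
    using prob_pair_pmf_Times[of P _ ?E UNIV] by (simp add: prob_pair_pmf_Times)
  also have "\<dots> \<le> \<delta> + 3 / 4 * (4 * \<delta>)"
    using assms Suc.IH by (intro add_mono mult_mono) auto
  finally show ?case by simp
qed

lemma Rbar_antimono: "\<epsilon> \<le> \<epsilon>' \<Longrightarrow> Rbar n \<epsilon>' g \<le> Rbar n \<epsilon> g"
  unfolding Rbar_def computes_def by (intro INF_superset_mono) (auto intro: order_trans[rotated])

text \<open>The fallback adds at most \<open>(3 / 4) ^ m * n\<close> to the expected cost. This
  falls below any \<open>e > 0\<close>, and \<open>Rbar\<close> is an infimum, so the bound holds
  without \<open>e\<close>.\<close>

lemma Rbar_le_retry:
  assumes alg: "query_algorithm n P"
    and none: "\<And>x. x \<in> cube n \<Longrightarrow> measure_pmf.prob P {T. run T x = None} \<le> 3 / 4"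
    and error: "\<And>x. x \<in> cube n \<Longrightarrow> measure_pmf.prob P {T. \<exists>b. run T x = Some b \<and> b \<noteq> f x} \<le> \<delta>"
    and cost: "\<And>T x. T \<in> set_pmf P \<Longrightarrow> x \<in> cube n \<Longrightarrow> num_queries T x \<le> d"
  shows "Rbar n (4 * \<delta>) f \<le> ennreal (4 * real d)"
proof (rule ennreal_le_epsilon)
  fix e :: real assume "e > 0"
  let ?S = "full_tree f n []" \<comment> \<open>fallback if all \<open>m\<close> attempts abort\<close>
  obtain m where m: "(3 / 4 :: real) ^ m < e / (real n + 1)"
    using real_arch_pow_inv[of "e / (real n + 1)" "3 / 4"] \<open>e > 0\<close> by auto
  have "(3 / 4) ^ m * real n \<le> (3 / 4) ^ m * (real n + 1)"
    by (intro mult_left_mono) auto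
  also have "\<dots> \<le> e"
    using m by (simp add: field_simps)
  finally have small: "(3 / 4) ^ m * real n \<le> e" .
  have "run ?S x = f x" if "x \<in> cube n" for x
    using run_full_tree[of f x "[]"] that by (simp add: cube_def)
  then have "measure_pmf.prob (retry m P ?S) {T. run T x \<noteq> f x} \<le> 4 * \<delta>" if "x \<in> cube n" for x
    using that by (intro error_retry none error)
  then have "computes n (retry m P ?S) f (4 * \<delta>)"
    unfolding computes_def using prob_pmf_not[of "retry m P ?S" "\<lambda>T. run T x = f x" for x] by force
  moreover have "query_algorithm n (retry m P ?S)"
    using queried_full_tree[of f n "[]"] by (intro query_algorithm_retry alg) simp
  ultimately have "Rbar n (4 * \<delta>) f \<le> (SUP x \<in> cube n. expected_queries (retry m P ?S) x)"
    unfolding Rbar_def by (intro INF_lower) simp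
  also have "\<dots> \<le> ennreal (4 * real d + (3 / 4) ^ m * real n)"
    using expected_queries_retry[where S = ?S and m = m, OF none cost] by (intro SUP_least) (simp add: num_queries_full_tree)
  also have "\<dots> \<le> ennreal (4 * real d + e)"
    using small by (intro ennreal_leI) simp
  finally show "Rbar n (4 * \<delta>) f \<le> ennreal (4 * real d) + ennreal e"
    using \<open>e > 0\<close> by simp
qed

text \<open>Two independent runs are both correct with probability at least \<open>1 / 4\<close>,
  which leaves aborts at most \<open>3 / 4\<close>; agreement on a wrong bit requires both to err.
  The cost \<open>2 * d\<close> of a pair and the factor 4 for repetition give
  \<open>8 * d\<close>.\<close>

lemma Rbar_le_agree:
  assumes alg: "query_algorithm n P"
    and fail: "\<And>x. x \<in> cube n \<Longrightarrow> measure_pmf.prob P {T. run T x \<noteq> Some (f x)} \<le> 1 / 2"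
    and error: "\<And>x. x \<in> cube n \<Longrightarrow> measure_pmf.prob P {T. \<exists>b. run T x = Some b \<and> b \<noteq> f x} \<le> \<delta>"
    and cost: "\<And>T x. T \<in> set_pmf P \<Longrightarrow> x \<in> cube n \<Longrightarrow> num_queries T x \<le> d"
  shows "Rbar n (4 * \<delta>\<^sup>2) f \<le> ennreal (8 * real d)"
proof -
  let ?P = "map_pmf (\<lambda>(T, S). agree T S) (pair_pmf P P)"
  have "Rbar n (4 * \<delta>\<^sup>2) f \<le> ennreal (4 * real (2 * d))"
  proof (rule Rbar_le_retry)
    show "query_algorithm n ?P"
      using alg queried_agree unfolding query_algorithm_def by fastforce
    show "num_queries T x \<le> 2 * d" if "T \<in> set_pmf ?P" "x \<in> cube n" for T x
      using that cost[of _ x] by (force simp: num_queries_agree mult_2 intro!: add_mono)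
  next
    fix x assume x: "x \<in> cube n"
    let ?G = "{T. run T x = Some (f x)}" and ?E = "{T. \<exists>b. run T x = Some b \<and> b \<noteq> f x}"
    have "measure_pmf.prob P ?G = 1 - measure_pmf.prob P {T. run T x \<noteq> Some (f x)}"
      using prob_pmf_not[of P "\<lambda>T. run T x = Some (f x)"] by simp
    then have "1 / 2 \<le> measure_pmf.prob P ?G"
      using fail[OF x] by simp
    then have "1 / 2 * (1 / 2) \<le> measure_pmf.prob P ?G * measure_pmf.prob P ?G"
      by (intro mult_mono) auto
    also have "\<dots> = measure_pmf.prob (pair_pmf P P) (?G \<times> ?G)"
      by (simp add: prob_pair_pmf_Times)
    also have "\<dots> \<le> measure_pmf.prob ?P {T. run T x \<noteq> None}"
      unfolding measure_map_pmf by (intro measure_pmf.finite_measure_mono) (auto simp: run_agree)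
    finally show "measure_pmf.prob ?P {T. run T x = None} \<le> 3 / 4"
      using prob_pmf_not[of ?P "\<lambda>T. run T x = None"] by simp
    have "measure_pmf.prob ?P ?E \<le> measure_pmf.prob (pair_pmf P P) (?E \<times> ?E)"
      unfolding measure_map_pmf
      by (intro measure_pmf.finite_measure_mono) (auto simp: run_agree split: if_splits, metis+)
    also have "\<dots> \<le> \<delta> * \<delta>"
      unfolding prob_pair_pmf_Times using error[OF x] measure_nonneg order_trans
      by (intro mult_mono) blast+
    finally show "measure_pmf.prob ?P ?E \<le> \<delta>\<^sup>2"
      by (simp add: power2_eq_square)
  qed
  then show ?thesis by simp
qed

section \<open>Simulating a tree for the direct sum on a single block\<close>

text \<open>The concatenation of \<open>Y 0\<close>, ..., \<open>Y (k - 1)\<close>. The form with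
  \<open>div\<close> and \<open>mod\<close> matches the way \<open>simulate\<close> splits a query
  position, and a function \<open>Y\<close> allows one block to be replaced by an update.\<close>

definition assemble :: "nat \<Rightarrow> nat \<Rightarrow> (nat \<Rightarrow> bool list) \<Rightarrow> bool list" where
  "assemble n k Y = map (\<lambda>j. Y (j div n) ! (j mod n)) [0..<n * k]"

lemma assemble_in_cube: "assemble n k Y \<in> cube (n * k)"
  by (simp add: assemble_def cube_def)

lemma nth_assemble: "j < n * k \<Longrightarrow> assemble n k Y ! j = Y (j div n) ! (j mod n)"
  by (simp add: assemble_def)

lemma block_assemble:
  assumes "i < k" "Y i \<in> cube n"
  shows "block n i (assemble n k Y) = Y i"
proof (rule nth_equalityI)
  have le: "i * n + n \<le> n * k"
    using mult_le_mono1[of "Suc i" k n] assms(1) by (simp add: mult.commute)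
  then show "length (block n i (assemble n k Y)) = length (Y i)"
    using assms by (simp add: block_def assemble_def cube_def)
  fix j assume "j < length (block n i (assemble n k Y))"
  then have "j < n" by (simp add: block_def)
  then have "block n i (assemble n k Y) ! j = assemble n k Y ! (i * n + j)"
    using le assms(1) unfolding block_def by (subst nth_take, simp, subst nth_drop) (simp_all add: assemble_def)
  also have "\<dots> = Y i ! j"
    using le \<open>j < n\<close> by (subst nth_assemble) simp_all
  finally show "block n i (assemble n k Y) ! j = Y i ! j" .
qed

lemma nth_direct_sum_assemble:
  "i < k \<Longrightarrow> Y i \<in> cube n \<Longrightarrow> direct_sum n k f (assemble n k Y) ! i = f (Y i)"
  by (simp add: direct_sum_def block_assemble)

text \<open>The budget \<open>d\<close> bounds the number of queries to block \<open>i\<close>; the bits of the other blocks are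
  taken from \<open>Y\<close>.\<close>

primrec simulate ::
    "nat \<Rightarrow> nat \<Rightarrow> (nat \<Rightarrow> bool list) \<Rightarrow> ('o \<Rightarrow> 'b option) \<Rightarrow> 'o dtree \<Rightarrow> nat \<Rightarrow> 'b option dtree" where
  "simulate n i Y g (Output v) d = Output (g v)"
| "simulate n i Y g (Query j l r) d =
     (if j div n = i then
        (case d of 0 \<Rightarrow> Output None
         | Suc d' \<Rightarrow> Query (j mod n) (simulate n i Y g l d') (simulate n i Y g r d'))
      else if Y (j div n) ! (j mod n) then simulate n i Y g r d else simulate n i Y g l d)"

primrec block_queries :: "nat \<Rightarrow> nat \<Rightarrow> 'o dtree \<Rightarrow> bool list \<Rightarrow> nat" where
  "block_queries n i (Output v) x = 0"
| "block_queries n i (Query j l r) x =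
     (if j div n = i then 1 else 0) + (if x ! j then block_queries n i r x else block_queries n i l x)"

text \<open>A position \<open>j < n * k\<close> lies in exactly one block,
  \<open>j div n < k\<close>.\<close>

lemma sum_block_queries:
  "queried B \<subseteq> {..<n * k} \<Longrightarrow> (\<Sum>i<k. block_queries n i B x) = num_queries B x"
proof (induction B)
  case (Query j l r)
  then have "j div n < k"
    by (simp add: less_mult_imp_div_less mult.commute)
  with Query show ?case
    by (auto simp: sum.distrib)
qed simp

text \<open>On \<open>Y i\<close> the simulation follows the path of \<open>B\<close> on the
  assembled input. Exactly \<open>d\<close> queries to block \<open>i\<close> are still allowed; the
  next one aborts.\<close>

lemma run_simulate:
  assumes "queried B \<subseteq> {..<n * k}"
  shows "run (simulate n i Y g B d) (Y i) =
    (if block_queries n i B (assemble n k Y) \<le> d then g (run B (assemble n k Y)) else None)"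
  using assms
proof (induction B arbitrary: d)
  case (Query j l r)
  then show ?case
    by (cases d) (auto simp: nth_assemble)
qed simp

lemma num_queries_simulate: "num_queries (simulate n i Y g B d) x \<le> d"
  by (induction B arbitrary: d) (auto split: nat.split)

lemma queried_simulate: "n > 0 \<Longrightarrow> queried (simulate n i Y g B d) \<subseteq> {..<n}"
  by (induction B arbitrary: d) (auto split: nat.split)

lemma simulate_upd: "simulate n i (Y(i := x)) g B d = simulate n i Y g B d"
  by (induction B arbitrary: d) (auto split: nat.split)

text \<open>The values \<open>f (Y j)\<close> of the sampled blocks are known to the simulator,
  \<open>f (Y i)\<close> is not; hence the strict \<open>j < i\<close>. An error can survive the
  check only at the first wrong coordinate.\<close>

definition check_prefix :: "(bool list \<Rightarrow> bool) \<Rightarrow> nat \<Rightarrow> (nat \<Rightarrow> bool list) \<Rightarrow> bool list \<Rightarrow> bool option" where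
  "check_prefix f i Y v = (if \<forall>j<i. v ! j = f (Y j) then Some (v ! i) else None)"

definition embedding ::
    "nat \<Rightarrow> (bool list \<Rightarrow> bool) \<Rightarrow> nat \<Rightarrow> nat \<Rightarrow> (nat \<Rightarrow> bool list) \<Rightarrow> bool list dtree \<Rightarrow> bool option dtree" where
  "embedding n f d i Y B = simulate n i Y (check_prefix f i Y) B d"

text \<open>Neither the simulation nor the prefix check looks at \<open>Y i\<close>, so the tree is
  chosen independently of the input placed in block \<open>i\<close>.\<close>

lemma embedding_upd: "embedding n f d i (Y(i := x)) B = embedding n f d i Y B"
proof -
  have "check_prefix f i (Y(i := x)) = check_prefix f i Y"
    by (auto simp: check_prefix_def)
  then show ?thesis
    by (simp add: embedding_def simulate_upd)
qed

section \<open>The average loss of an embedded tree\<close>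

definition loss :: "(bool list \<Rightarrow> bool) \<Rightarrow> real \<Rightarrow> bool option dtree \<Rightarrow> bool list \<Rightarrow> real" where
  "loss f W T x = (case run T x of None \<Rightarrow> 1 | Some b \<Rightarrow> if b = f x then 0 else W)"

lemma loss_nonneg: "W \<ge> 0 \<Longrightarrow> loss f W T x \<ge> 0"
  by (simp add: loss_def split: option.split)

text \<open>Three sources of loss: at most \<open>num_queries B z / (d + 1)\<close> blocks exceed
  the budget; prefix aborts occur only if the output is wrong, at most \<open>k\<close> times; and
  the penalty \<open>W\<close> is paid only at the unique first wrong coordinate.\<close>

lemma sum_loss_embedding_le:
  assumes B: "queried B \<subseteq> {..<n * k}" and Y: "\<And>j. j < k \<Longrightarrow> Y j \<in> cube n" and "W \<ge> 0"
  defines "z \<equiv> assemble n k Y"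
  shows "(\<Sum>i<k. loss f W (embedding n f d i Y B) (Y i))
    \<le> (real k + W) * of_bool (run B z \<noteq> direct_sum n k f z) + real (num_queries B z) / (real d + 1)"
proof -
  let ?wrong = "run B z \<noteq> direct_sum n k f z"
  let ?v = "run B z"
  let ?first = "\<lambda>i. (\<forall>j<i. ?v ! j = f (Y j)) \<and> ?v ! i \<noteq> f (Y i)"
  have wrong: "?wrong" if "?v ! j \<noteq> f (Y j)" "j < k" for j
    using that Y nth_direct_sum_assemble[of j k Y n f] unfolding z_def by metis
  have one: "loss f W (embedding n f d i Y B) (Y i)
      \<le> real (block_queries n i B z) / (real d + 1) + of_bool ?wrong + W * of_bool (?first i)"
    if "i < k" for i
  proof -
    \<comment> \<open>A count above the integer \<open>d\<close> is at least \<open>d + 1\<close>,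
      whence this divisor.\<close>
    have "1 \<le> real (block_queries n i B z) / (real d + 1)" if "\<not> block_queries n i B z \<le> d"
      using that by (simp add: field_simps)
    moreover have "0 \<le> real (block_queries n i B z) / (real d + 1)"
      by simp
    moreover have "?wrong" if "\<exists>j<i. ?v ! j \<noteq> f (Y j)"
      using that wrong \<open>i < k\<close> by (meson less_trans)
    ultimately show ?thesis
      using \<open>W \<ge> 0\<close> unfolding loss_def embedding_def run_simulate[OF B] z_def[symmetric]
      by (auto simp: check_prefix_def add_increasing add_increasing2)
  qed
  have first: "(\<Sum>i<k. of_bool (?first i)) \<le> (of_bool ?wrong :: real)"
  proof (cases "\<exists>i<k. ?first i")
    case True
    then obtain i where i: "i < k" "?first i" by blast
    have "?first j \<longleftrightarrow> j = i" for j
      using i(2) by (metis linorder_neqE_nat)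
    then have "(\<Sum>j<k. of_bool (?first j)) = (\<Sum>j<k. of_bool (j = i) :: real)"
      by simp
    then show ?thesis
      using i wrong[of i] by simp
  next
    case False
    then have "(\<Sum>i<k. of_bool (?first i)) = (0 :: real)"
      by (intro sum.neutral) auto
    then show ?thesis by simp
  qed
  have "(\<Sum>i<k. loss f W (embedding n f d i Y B) (Y i))
      \<le> (\<Sum>i<k. real (block_queries n i B z) / (real d + 1) + of_bool ?wrong + W * of_bool (?first i))"
    by (intro sum_mono one) simp
  also have "\<dots> = real (\<Sum>i<k. block_queries n i B z) / (real d + 1) + real k * of_bool ?wrong
      + W * (\<Sum>i<k. of_bool (?first i))"
    by (simp only: sum.distrib sum_distrib_left sum_divide_distrib of_nat_sum sum_constant card_lessThan)
  also have "\<dots> \<le> real (num_queries B z) / (real d + 1) + real k * of_bool ?wrong + W * of_bool ?wrong"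
    using first \<open>W \<ge> 0\<close> by (intro add_mono mult_left_mono) (simp_all add: sum_block_queries[OF B])
  finally show ?thesis
    by (simp add: algebra_simps)
qed

text \<open>With \<open>i\<close> uniform, \<open>B\<close> from \<open>A\<close> and all blocks
  independent from \<open>\<mu>\<close>, the average loss is bounded by
  \<open>sum_loss_embedding_le\<close>. Fixing \<open>i\<close>, then \<open>B\<close>, then the
  other blocks at values no worse than average leaves only the input \<open>x\<close> from
  \<open>\<mu>\<close> random.\<close>

lemma ex_embedding_loss_le:
  assumes n: "n > 0" and k: "k > 0" and \<mu>: "set_pmf \<mu> \<subseteq> cube n"
    and A: "query_algorithm (n * k) A" "computes (n * k) A (direct_sum n k f) \<epsilon>"
    and q: "\<And>x. x \<in> cube (n * k) \<Longrightarrow> expected_queries A x \<le> ennreal q" "q \<ge> 0"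
    and "W \<ge> 0" "\<epsilon> \<ge> 0"
  shows "\<exists>i<k. \<exists>B\<in>set_pmf A. \<exists>Y. (\<forall>j<k. j \<noteq> i \<longrightarrow> Y j \<in> cube n) \<and>
    (\<integral>\<^sup>+x. ennreal (loss f W (embedding n f d i Y B) x) \<partial>\<mu>)
      \<le> ennreal (((real k + W) * \<epsilon> + q / (real d + 1)) / real k)"
proof -
  define R where "R = (real k + W) * \<epsilon> + q / (real d + 1)"
  define G where "G i B Y = ennreal (loss f W (embedding n f d i Y B) (Y i))" for i B Y
  let ?I = "pmf_of_set {..<k}" and ?Y = "Pi_pmf {..<k} [] (\<lambda>_. \<mu>)"
  have "R \<ge> 0"
    using assms by (simp add: R_def)
  have fixed: "(\<integral>\<^sup>+B. (\<Sum>i<k. G i B Y) \<partial>A) \<le> ennreal R" if Y: "\<And>j. j < k \<Longrightarrow> Y j \<in> cube n" for Y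
  proof -
    let ?z = "assemble n k Y"
    have "(\<integral>\<^sup>+B. (\<Sum>i<k. G i B Y) \<partial>A)
        \<le> (\<integral>\<^sup>+B. ennreal (real k + W) * indicator {B. run B ?z \<noteq> direct_sum n k f ?z} B
              + ennreal (1 / (real d + 1)) * of_nat (num_queries B ?z) \<partial>A)"
    proof (intro nn_integral_mono_AE, unfold AE_measure_pmf_iff, intro ballI)
      fix B assume "B \<in> set_pmf A"
      then have "queried B \<subseteq> {..<n * k}"
        using A by (simp add: query_algorithm_def)
      have "(\<Sum>i<k. G i B Y) = ennreal (\<Sum>i<k. loss f W (embedding n f d i Y B) (Y i))"
        unfolding G_def using \<open>W \<ge> 0\<close> by (intro sum_ennreal loss_nonneg)
      also have "\<dots> \<le> ennreal ((real k + W) * of_bool (run B ?z \<noteq> direct_sum n k f ?z)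
          + real (num_queries B ?z) / (real d + 1))"
        by (intro ennreal_leI sum_loss_embedding_le) fact+
      also have "\<dots> = ennreal (real k + W) * indicator {B. run B ?z \<noteq> direct_sum n k f ?z} B
              + ennreal (1 / (real d + 1)) * of_nat (num_queries B ?z)"
        using \<open>W \<ge> 0\<close> by (simp add: ennreal_of_nat_eq_real_of_nat ennreal_mult''[symmetric] indicator_def)
      finally show "(\<Sum>i<k. G i B Y) \<le> \<dots>" .
    qed
    also have "\<dots> = ennreal (real k + W) * emeasure A {B. run B ?z \<noteq> direct_sum n k f ?z}
        + ennreal (1 / (real d + 1)) * expected_queries A ?z"
      by (simp add: nn_integral_add nn_integral_cmult expected_queries_def)
    also have "\<dots> \<le> ennreal (real k + W) * ennreal \<epsilon> + ennreal (1 / (real d + 1)) * ennreal q"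
    proof (intro add_mono mult_left_mono q assemble_in_cube)
      have "measure_pmf.prob A {B. run B ?z = direct_sum n k f ?z} \<ge> 1 - \<epsilon>"
        using A assemble_in_cube unfolding computes_def by blast
      then show "emeasure A {B. run B ?z \<noteq> direct_sum n k f ?z} \<le> ennreal \<epsilon>"
        using prob_pmf_not[of A "\<lambda>B. run B ?z = direct_sum n k f ?z"]
        by (simp add: measure_pmf.emeasure_eq_measure ennreal_leI)
    qed auto
    also have "\<dots> = ennreal R"
      using assms by (simp add: R_def ennreal_mult''[symmetric] ennreal_plus[symmetric] del: ennreal_plus)
    finally show ?thesis .
  qed
  \<comment> \<open>Exchanging sum and integrals brings the sum over \<open>i\<close> and the
    average over \<open>A\<close> inside the average over \<open>Y\<close>, where
    \<open>fixed\<close> applies.\<close>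
  have "(\<integral>\<^sup>+i. \<integral>\<^sup>+B. \<integral>\<^sup>+Y. G i B Y \<partial>?Y \<partial>A \<partial>?I) = (\<Sum>i<k. \<integral>\<^sup>+B. \<integral>\<^sup>+Y. G i B Y \<partial>?Y \<partial>A) / of_nat k"
    using k by (simp add: nn_integral_pmf_of_set lessThan_empty_iff)
  also have "(\<Sum>i<k. \<integral>\<^sup>+B. \<integral>\<^sup>+Y. G i B Y \<partial>?Y \<partial>A) = (\<integral>\<^sup>+B. \<integral>\<^sup>+Y. (\<Sum>i<k. G i B Y) \<partial>?Y \<partial>A)"
    by (simp add: nn_integral_sum)
  also have "\<dots> = (\<integral>\<^sup>+p. (\<Sum>i<k. G i (fst p) (snd p)) \<partial>pair_pmf A ?Y)"
    by (simp add: nn_integral_pair_pmf')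
  also have "\<dots> = (\<integral>\<^sup>+Y. \<integral>\<^sup>+B. (\<Sum>i<k. G i B Y) \<partial>A \<partial>?Y)"
    by (subst pair_commute_pmf) (simp add: nn_integral_pair_pmf' case_prod_unfold)
  also have "\<dots> \<le> (\<integral>\<^sup>+Y. ennreal R \<partial>?Y)"
  proof (intro nn_integral_mono_AE, unfold AE_measure_pmf_iff, intro ballI fixed)
    fix Y j assume "Y \<in> set_pmf ?Y" "j < k"
    then show "Y j \<in> cube n"
      using \<mu> by (auto simp: set_Pi_pmf PiE_dflt_def)
  qed
  also have "\<dots> / of_nat k = ennreal (R / real k)"
    using \<open>R \<ge> 0\<close> k by (simp add: ennreal_of_nat_eq_real_of_nat divide_ennreal)
  finally have "(\<integral>\<^sup>+i. \<integral>\<^sup>+B. \<integral>\<^sup>+Y. G i B Y \<partial>?Y \<partial>A \<partial>?I) \<le> ennreal (R / real k)"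
    by (simp add: divide_right_mono_ennreal)
  from nn_integral_pmf_le_imp_ex[OF this] obtain i
    where i: "i < k" "(\<integral>\<^sup>+B. \<integral>\<^sup>+Y. G i B Y \<partial>?Y \<partial>A) \<le> ennreal (R / real k)"
    using k by (auto simp: lessThan_empty_iff)
  from nn_integral_pmf_le_imp_ex[OF i(2)] obtain B
    where B: "B \<in> set_pmf A" "(\<integral>\<^sup>+Y. G i B Y \<partial>?Y) \<le> ennreal (R / real k)"
    by auto
  \<comment> \<open>Block \<open>i\<close> is split off as an independent sample of
    \<open>\<mu>\<close>. Functions drawn from \<open>?Y'\<close> take the default \<open>[]\<close>
    at \<open>i\<close>, so membership in the cube is claimed only for
    \<open>j \<noteq> i\<close>.\<close>
  let ?Y' = "Pi_pmf ({..<k} - {i}) [] (\<lambda>_. \<mu>)"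
  have "?Y = map_pmf (\<lambda>(x, Y). Y(i := x)) (pair_pmf \<mu> ?Y')"
    using Pi_pmf_insert[of "{..<k} - {i}" i "[]" "\<lambda>_. \<mu>"] i(1) by (simp add: insert_absorb)
  also have "pair_pmf \<mu> ?Y' = map_pmf (\<lambda>(x, y). (y, x)) (pair_pmf ?Y' \<mu>)"
    by (rule pair_commute_pmf)
  finally have "(\<integral>\<^sup>+Y. G i B Y \<partial>?Y)
      = (\<integral>\<^sup>+Y. \<integral>\<^sup>+x. ennreal (loss f W (embedding n f d i Y B) x) \<partial>\<mu> \<partial>?Y')"
    by (simp only: nn_integral_map_pmf nn_integral_pair_pmf' prod.case G_def embedding_upd fun_upd_same)
  with B(2) have "(\<integral>\<^sup>+Y. \<integral>\<^sup>+x. ennreal (loss f W (embedding n f d i Y B) x) \<partial>\<mu> \<partial>?Y') \<le> ennreal (R / real k)"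
    by simp
  from nn_integral_pmf_le_imp_ex[OF this] obtain Y where Y: "Y \<in> set_pmf ?Y'"
      "(\<integral>\<^sup>+x. ennreal (loss f W (embedding n f d i Y B) x) \<partial>\<mu>) \<le> ennreal (R / real k)"
    by auto
  have "Y j \<in> cube n" if "j < k" "j \<noteq> i" for j
    using Y(1) that \<mu> by (auto simp: set_Pi_pmf PiE_dflt_def)
  with i(1) B(1) Y(2) show ?thesis
    unfolding R_def by blast
qed

lemma ex_pmf_of_weights:
  fixes w :: "'a \<Rightarrow> real"
  assumes "finite X" "\<And>x. 0 \<le> w x" "sum w X > 0"
  shows "\<exists>\<mu>. \<forall>x. pmf \<mu> x = (if x \<in> X then w x / sum w X else 0)"
proof -
  let ?f = "\<lambda>x. if x \<in> X then w x / sum w X else 0"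
  have "(\<integral>\<^sup>+x. ennreal (?f x) \<partial>count_space UNIV) = (\<Sum>x\<in>X. ennreal (?f x))"
    using assms(1) by (intro nn_integral_count_space') auto
  also have "\<dots> = ennreal (\<Sum>x\<in>X. ?f x)"
    using assms by (intro sum_ennreal) auto
  also have "(\<Sum>x\<in>X. ?f x) = 1"
    using assms(3) by (simp add: sum_divide_distrib[symmetric])
  finally have "(\<integral>\<^sup>+x. ennreal (?f x) \<partial>count_space UNIV) = 1" by simp
  then have "pmf (embed_pmf ?f) x = ?f x" for x
    using assms by (intro pmf_embed_pmf) auto
  then show ?thesis by blast
qed

text \<open>Zero error of a discrete distribution means that every tree in its support is correct on
  every input, in particular on the one with \<open>x\<close> in block \<open>i\<close>.\<close>

lemma embedding_zero_error:
  assumes A: "query_algorithm (n * k) A" "computes (n * k) A (direct_sum n k f) 0" "B \<in> set_pmf A"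
    and Y: "\<forall>j<k. j \<noteq> i \<longrightarrow> Y j \<in> cube n" and i: "i < k" and x: "x \<in> cube n"
  shows "run (embedding n f d i Y B) x \<in> {None, Some (f x)}"
proof -
  let ?Y = "Y(i := x)"
  let ?z = "assemble n k ?Y"
  have "measure_pmf.prob A {T. run T ?z = direct_sum n k f ?z} \<ge> 1"
    using A(2) assemble_in_cube[of n k ?Y] by (simp add: computes_def)
  then have "AE T in measure_pmf A. T \<in> {T. run T ?z = direct_sum n k f ?z}"
    by (intro measure_pmf.AE_prob_1 antisym) auto
  then have "run B ?z = direct_sum n k f ?z"
    using A(3) by (simp add: AE_measure_pmf_iff)
  moreover have "direct_sum n k f ?z ! i = f x"
    using i x nth_direct_sum_assemble[of i k ?Y n f] by simp
  moreover have "queried B \<subseteq> {..<n * k}"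
    using A by (simp add: query_algorithm_def)
  from run_simulate[OF this, of i ?Y "check_prefix f i ?Y" d]
  have "run (embedding n f d i Y B) x =
      (if block_queries n i B ?z \<le> d then check_prefix f i ?Y (run B ?z) else None)"
    using embedding_upd[of n f d i Y x B] by (simp add: embedding_def)
  ultimately show ?thesis
    by (simp add: check_prefix_def)
qed

section \<open>The reduction and its constants\<close>

lemma Rbar_le_of_direct_sum_algorithm:
  assumes n: "n > 0" and k: "k \<ge> 2" and \<epsilon>: "0 \<le> \<epsilon>" "\<epsilon> \<le> 1 / 20"
    and A: "query_algorithm (n * k) A" "computes (n * k) A (direct_sum n k f) \<epsilon>"
    and q: "\<And>x. x \<in> cube (n * k) \<Longrightarrow> expected_queries A x \<le> ennreal q" "q \<ge> 0"
  shows "Rbar n (\<epsilon> / real k) f \<le> ennreal (160 * q / real k)"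
proof -
  define d where "d = nat \<lfloor>20 * q / real k\<rfloor>"
  \<comment> \<open>The error term becomes \<open>W * \<epsilon> = k / 4\<close>. For
    \<open>\<epsilon> = 0\<close> the quotient would be 0 in HOL, while \<open>W \<ge> 1\<close> is
    needed below.\<close>
  define W where "W = (if \<epsilon> = 0 then 1 else real k / (4 * \<epsilon>))"
  have "real d = of_int \<lfloor>20 * q / real k\<rfloor>"
    using q by (simp add: d_def)
  then have d: "real d \<le> 20 * q / real k" "20 * q / real k < real d + 1"
    by linarith+
  have W: "W \<ge> 1" "W * \<epsilon> \<le> real k / 4"
    using \<epsilon> k by (auto simp: W_def field_simps)
  \<comment> \<open>In units of \<open>k\<close>: \<open>1 / 20\<close> for prefix aborts,
    \<open>1 / 4\<close> for errors and \<open>1 / 20\<close> for exceeded budgets.\<close>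
  have value_le: "((real k + W) * \<epsilon> + q / (real d + 1)) / real k \<le> 7 / 20"
  proof -
    have "q / (real d + 1) \<le> real k / 20"
      using d k by (simp add: field_simps)
    moreover have "real k * \<epsilon> \<le> real k * (1 / 20)"
      using \<epsilon> by (intro mult_left_mono) auto
    ultimately have "(real k + W) * \<epsilon> + q / (real d + 1) \<le> real k * (7 / 20)"
      using W unfolding distrib_right by linarith
    then show ?thesis
      using k by (simp add: pos_divide_le_eq mult.commute)
  qed
  \<comment> \<open>For \<open>\<epsilon> = 0\<close> no finite penalty \<open>W\<close> forces zero error, so erring trees are excluded outright.\<close>
  define \<T> where "\<T> = {T. queried T \<subseteq> {..<n} \<and> (\<forall>x. num_queries T x \<le> d) \<and>
    (\<epsilon> = 0 \<longrightarrow> (\<forall>x\<in>cube n. run T x \<in> {None, Some (f x)}))}"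
  have loss_le: "loss f W T x \<le> W" for T x
    using W by (simp add: loss_def split: option.split)
  \<comment> \<open>The slack \<open>3 / 20\<close> raises the guaranteed loss from
    \<open>7 / 20\<close> to \<open>1 / 2\<close>.\<close>
  have "\<exists>p. set_pmf p \<subseteq> \<T> \<and>
      (\<forall>x\<in>cube n. measure_pmf.expectation p (\<lambda>T. loss f W T x) \<le> 7 / 20 + 3 / 20)"
  proof (rule approximate_minimax)
    show "\<bar>loss f W T x\<bar> \<le> W" for T x
      using W loss_le[of T x] loss_nonneg[of W f T x] by simp
  next
    fix w :: "bool list \<Rightarrow> real" assume w: "\<And>x. 0 \<le> w x"
    let ?S = "sum w (cube n)"
    show "\<exists>T\<in>\<T>. (\<Sum>x\<in>cube n. w x * loss f W T x) \<le> ?S * (7 / 20)"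
    \<comment> \<open>Zero weights cannot be normalized to a distribution, but then any tree in
      \<open>\<T>\<close> responds.\<close>
    proof (cases "?S = 0")
      case True
      then have "w x = 0" if "x \<in> cube n" for x
        using w that by (simp add: sum_nonneg_eq_0_iff finite_cube)
      moreover have "Output None \<in> \<T>"
        by (simp add: \<T>_def)
      ultimately show ?thesis
        by (intro bexI[of _ "Output None"]) simp_all
    next
      case False
      then have S: "?S > 0"
        using w sum_nonneg[of "cube n" w] by (simp add: less_le)
      from ex_pmf_of_weights[OF finite_cube w this]
      obtain \<mu> where \<mu>: "\<And>x. pmf \<mu> x = (if x \<in> cube n then w x / ?S else 0)"
        by blast
      then have supp: "set_pmf \<mu> \<subseteq> cube n"
        by (auto simp: set_pmf_eq split: if_splits)
      from ex_embedding_loss_le[where d = d and W = W, OF n _ supp A q] k W \<epsilon>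
      obtain i B Y where T: "i < k" "B \<in> set_pmf A" "\<forall>j<k. j \<noteq> i \<longrightarrow> Y j \<in> cube n"
          "(\<integral>\<^sup>+x. ennreal (loss f W (embedding n f d i Y B) x) \<partial>\<mu>)
            \<le> ennreal (((real k + W) * \<epsilon> + q / (real d + 1)) / real k)"
        by fastforce
      let ?T = "embedding n f d i Y B"
      have "(\<integral>\<^sup>+x. ennreal (loss f W ?T x) \<partial>\<mu>) = (\<Sum>x\<in>cube n. ennreal (loss f W ?T x) * ennreal (pmf \<mu> x))"
        using supp by (intro nn_integral_measure_pmf_support finite_cube) auto
      also have "\<dots> = (\<Sum>x\<in>cube n. ennreal (w x * loss f W ?T x / ?S))"
        using W S w loss_nonneg[of W f ?T]
        by (intro sum.cong) (simp_all add: \<mu> ennreal_mult''[symmetric] mult.commute)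
      also have "\<dots> = ennreal ((\<Sum>x\<in>cube n. w x * loss f W ?T x) / ?S)"
        using W S w loss_nonneg[of W f ?T] by (subst sum_ennreal) (simp_all add: sum_divide_distrib)
      finally have "ennreal ((\<Sum>x\<in>cube n. w x * loss f W ?T x) / ?S) \<le> ennreal (7 / 20)"
        using order_trans[OF T(4) ennreal_leI[OF value_le]] by (simp only:)
      then have "(\<Sum>x\<in>cube n. w x * loss f W ?T x) / ?S \<le> 7 / 20"
        by (simp add: ennreal_le_iff)
      then have "(\<Sum>x\<in>cube n. w x * loss f W ?T x) \<le> ?S * (7 / 20)"
        using S by (simp add: pos_divide_le_eq mult.commute)
      moreover have "?T \<in> \<T>"
        using n embedding_zero_error[OF A(1) _ T(2,3,1)] A(2)
        by (auto simp: \<T>_def embedding_def num_queries_simulate dest: queried_simulate[THEN subsetD])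
      ultimately show ?thesis by blast
    qed
  qed (auto simp: finite_cube)
  then obtain p where p: "set_pmf p \<subseteq> \<T>"
      "\<And>x. x \<in> cube n \<Longrightarrow> measure_pmf.expectation p (\<lambda>T. loss f W T x) \<le> 1 / 2"
    by auto
  have integrable: "integrable (measure_pmf p) (\<lambda>T. loss f W T x)" for x
    using W loss_le loss_nonneg[of W f _ x]
    by (intro measure_pmf.integrable_const_bound[where B = W]) auto
  have integrable_indicator: "integrable (measure_pmf p) (indicator S :: _ \<Rightarrow> real)" for S
    by (intro measure_pmf.integrable_const_bound[where B = 1]) (auto simp: indicator_def)
  have "Rbar n (4 * (2 * \<epsilon> / real k)\<^sup>2) f \<le> ennreal (8 * real d)"
  proof (rule Rbar_le_agree)
    show "query_algorithm n p"
      using p(1) by (auto simp: query_algorithm_def \<T>_def)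
    show "num_queries T x \<le> d" if "T \<in> set_pmf p" for T x
      using that p(1) by (auto simp: \<T>_def)
  next
    fix x assume x: "x \<in> cube n"
    let ?F = "{T. run T x \<noteq> Some (f x)}" and ?E = "{T. \<exists>b. run T x = Some b \<and> b \<noteq> f x}"
    have "measure_pmf.prob p ?F = measure_pmf.expectation p (indicator ?F)"
      by simp
    \<comment> \<open>Since \<open>W \<ge> 1\<close>, aborts and errors alike are charged at least
      1.\<close>
    also have "\<dots> \<le> measure_pmf.expectation p (\<lambda>T. loss f W T x)"
      using W by (intro integral_mono integrable integrable_indicator integrable_mult_right)
        (auto simp: loss_def indicator_def split: option.split)
    also note p(2)[OF x]
    finally show "measure_pmf.prob p ?F \<le> 1 / 2" .
    show "measure_pmf.prob p ?E \<le> 2 * \<epsilon> / real k"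
    proof (cases "\<epsilon> = 0")
      case True
      then have "\<forall>T\<in>set_pmf p. T \<notin> ?E"
        using p(1) x by (fastforce simp: \<T>_def)
      then have "measure_pmf.prob p ?E = 0"
        by (subst measure_pmf_zero_iff) blast
      with True show ?thesis by simp
    next
      case False
      \<comment> \<open>Markov's inequality: the error is at most
        \<open>1 / (2 * W) = 2 * \<epsilon> / k\<close>.\<close>
      have "W * measure_pmf.prob p ?E = measure_pmf.expectation p (\<lambda>T. W * indicator ?E T)"
        by simp
      also have "\<dots> \<le> measure_pmf.expectation p (\<lambda>T. loss f W T x)"
        using W by (intro integral_mono integrable integrable_indicator integrable_mult_right)
          (auto simp: loss_def indicator_def split: option.split)
      also note p(2)[OF x]
      finally show ?thesis
        using False \<epsilon> k by (simp add: W_def field_simps)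
    qed
  qed
  \<comment> \<open>Squaring has gained a factor \<open>\<epsilon> / k\<close>, which absorbs the
    constant 16 because \<open>16 * \<epsilon> < 1\<close>.\<close>
  moreover have "4 * (2 * \<epsilon> / real k)\<^sup>2 \<le> \<epsilon> / real k"
  proof -
    have "\<epsilon> * 16 \<le> real k"
      using \<epsilon> k by linarith
    then have "(\<epsilon> / real k) * (\<epsilon> * 16 / real k) \<le> (\<epsilon> / real k) * 1"
      using \<epsilon> k by (intro mult_left_mono) auto
    then show ?thesis
      by (simp add: power2_eq_square mult_ac)
  qed
  ultimately have "Rbar n (\<epsilon> / real k) f \<le> ennreal (8 * real d)"
    using Rbar_antimono order_trans by blast
  also have "\<dots> \<le> ennreal (160 * q / real k)"
    using d(1) by (intro ennreal_leI) simp
  finally show ?thesis .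
qed

theorem theorem1p2:
  "\<exists>c::real. c > 0 \<and>
     (\<forall>(n::nat) (f :: bool list \<Rightarrow> bool) (k::nat) (\<epsilon>::real).
        n \<ge> 1 \<longrightarrow> k \<ge> 2 \<longrightarrow> 0 \<le> \<epsilon> \<longrightarrow> \<epsilon> \<le> 1 / 20 \<longrightarrow>
        Rbar (n * k) \<epsilon> (direct_sum n k f) \<ge> ennreal (c * real k) * Rbar n (\<epsilon> / real k) f)"
\<comment> \<open>\<open>160 = 8 * 20\<close>: the factor 8 of \<open>Rbar_le_agree\<close> times
  the budget \<open>20 * q / k\<close>.\<close>
proof (intro exI[of _ "1 / 160"] conjI allI impI)
  fix n k :: nat and f :: "bool list \<Rightarrow> bool" and \<epsilon> :: real
  assume *: "n \<ge> 1" "k \<ge> 2" "0 \<le> \<epsilon>" "\<epsilon> \<le> 1 / 20"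
  show "ennreal (1 / 160 * real k) * Rbar n (\<epsilon> / real k) f \<le> Rbar (n * k) \<epsilon> (direct_sum n k f)"
    unfolding Rbar_def[of "n * k"]
  proof (intro INF_greatest)
    fix A assume "A \<in> {A. query_algorithm (n * k) A \<and> computes (n * k) A (direct_sum n k f) \<epsilon>}"
    then have A: "query_algorithm (n * k) A" "computes (n * k) A (direct_sum n k f) \<epsilon>"
      by auto
    show "ennreal (1 / 160 * real k) * Rbar n (\<epsilon> / real k) f \<le> (SUP x \<in> cube (n * k). expected_queries A x)"
    proof (cases "SUP x \<in> cube (n * k). expected_queries A x")
      case (real q)
      have "expected_queries A x \<le> ennreal q" if "x \<in> cube (n * k)" for x
        using that unfolding real(2)[symmetric] by (intro SUP_upper)
      with * A real(1) have "Rbar n (\<epsilon> / real k) f \<le> ennreal (160 * q / real k)"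
        by (intro Rbar_le_of_direct_sum_algorithm) auto
      then have "ennreal (1 / 160 * real k) * Rbar n (\<epsilon> / real k) f
          \<le> ennreal (1 / 160 * real k) * ennreal (160 * q / real k)"
        by (rule mult_left_mono) simp
      also have "\<dots> = ennreal q"
        using * real(1) by (simp add: ennreal_mult''[symmetric])
      finally show ?thesis
        using real(2) by simp
    next
      case top
      then show ?thesis by (simp only: top_greatest)
    qed
  qed
qed simp
end
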